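(* Let $M$ be a nontrivial Puiseux monoid, and let $F$ be a finitely generated (additive) monoid. (1) If $\theta \colon M \to F$ is a monoid homomorphism satisfying $\theta^{-1}(0) = \{0\}$, then $M$ is isomorphic to a numerical monoid. (2) The Puiseux monoid $M$ is transfer finite if and only if it is isomorphic to a numerical monoid.
   Context: A monoid is a commutative cancellative semigroup with identity; $M^\times$ denotes its group of units. A Puiseux monoid is an additive submonoid of $\mathbb{Q}_{\ge 0}$; it is nontrivial if it is not $\{0\}$. A numerical monoid is a submonoid of $(\mathbb{N}_0,+)$ with finite complement in $\mathbb{N}_0$. A monoid homomorphism $\theta \colon M \to N$ (written multiplicatively) is a transfer homomorphism if: (T1) $N = \theta(M) N^\times$ and $\theta^{-1}(N^\times) = M^\times$; (T2) whenever $\theta(a) = b_1 b_2$ with $a \in M$ and $b_1, b_2 \in N$, there exist $a_1, a_2 \in M$ such that $a = a_1 a_2$ and $\theta(a_i) = b_i$ for $i \in \{1,2\}$. A Puiseux monoid is transfer finite if there exists a transfer homomorphism from it to some finitely generated monoid. *)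

theory Defs
  imports "HOL-Algebra.Algebra" "HOL-Library.Countable_Set"
begin

text \<open>
  Monoids are commutative and cancellative throughout, i.e. structures satisfying
  the library locale \<^locale>\<open>comm_monoid_cancel\<close>. Additively written monoids are
  the same structures, with \<open>\<otimes>\<close> read as addition and \<open>\<one>\<close> as zero.
\<close>

definition additive_monoid_on :: "'a::monoid_add set \<Rightarrow> 'a monoid" where
  "additive_monoid_on S = \<lparr>carrier = S, monoid.mult = (+), monoid.one = 0\<rparr>"

definition puiseux_monoid :: "rat set \<Rightarrow> bool" where
  "puiseux_monoid M \<longleftrightarrow> submonoid M (additive_monoid_on {q. 0 \<le> q})"

definition numerical_monoid :: "nat set \<Rightarrow> bool" where
  "numerical_monoid S \<longleftrightarrow> submonoid S (additive_monoid_on UNIV) \<and> finite (- S)"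

text \<open>
  The library relation \<open>\<cong>\<close> does not mention the identity, but a multiplicative
  bijection between monoids necessarily preserves it.
\<close>

definition isomorphic_to_numerical_monoid :: "rat set \<Rightarrow> bool" where
  "isomorphic_to_numerical_monoid M \<longleftrightarrow>
     (\<exists>S. numerical_monoid S \<and> additive_monoid_on M \<cong> additive_monoid_on S)"

definition finitely_generated_monoid :: "('a, 'm) monoid_scheme \<Rightarrow> bool" where
  "finitely_generated_monoid G \<longleftrightarrow>
     (\<exists>A. finite A \<and> A \<subseteq> carrier G \<and> (\<lambda>H. submonoid H G) hull A = carrier G)"

text \<open>Unlike \<^const>\<open>hom\<close>, which is meant for groups, this includes preservation of the identity.\<close>

definition monoid_hom :: "('a, 'm) monoid_scheme \<Rightarrow> ('b, 'n) monoid_scheme \<Rightarrow> ('a \<Rightarrow> 'b) set" where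
  "monoid_hom M N = {\<theta> \<in> hom M N. \<theta> \<one>\<^bsub>M\<^esub> = \<one>\<^bsub>N\<^esub>}"

definition transfer_hom :: "('a, 'm) monoid_scheme \<Rightarrow> ('b, 'n) monoid_scheme \<Rightarrow> ('a \<Rightarrow> 'b) set" where
  "transfer_hom M N = {\<theta> \<in> monoid_hom M N.
     carrier N = (\<theta> ` carrier M) <#>\<^bsub>N\<^esub> Units N \<and>
     {a \<in> carrier M. \<theta> a \<in> Units N} = Units M \<and>
     (\<forall>a \<in> carrier M. \<forall>b1 \<in> carrier N. \<forall>b2 \<in> carrier N.
        \<theta> a = b1 \<otimes>\<^bsub>N\<^esub> b2 \<longrightarrow>
        (\<exists>a1 \<in> carrier M. \<exists>a2 \<in> carrier M.
           a = a1 \<otimes>\<^bsub>M\<^esub> a2 \<and> \<theta> a1 = b1 \<and> \<theta> a2 = b2))}"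

text \<open>
  HOL cannot quantify existentially over the type carrying the target monoid. Since finitely
  generated monoids are countable, no generality is lost by taking its elements to be natural
  numbers (with an arbitrary operation); \<open>transfer_finiteI\<close> below proves this.
\<close>

definition transfer_finite :: "rat set \<Rightarrow> bool" where
  "transfer_finite M \<longleftrightarrow>
     (\<exists>N :: nat monoid. comm_monoid_cancel N \<and> finitely_generated_monoid N \<and>
        transfer_hom (additive_monoid_on M) N \<noteq> {})"

lemma finitely_generated_monoid_countable:
  assumes "monoid G" and "finitely_generated_monoid G"
  shows "countable (carrier G)"
proof -
  interpret monoid G by fact
  obtain A where A: "finite A" "A \<subseteq> carrier G" "(\<lambda>H. submonoid H G) hull A = carrier G"
    using assms(2) unfolding finitely_generated_monoid_def by blast
  define P where "P xs = foldr (\<lambda>x y. x \<otimes>\<^bsub>G\<^esub> y) xs \<one>\<^bsub>G\<^esub>" for xs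
  have Pc: "P xs \<in> carrier G" if "xs \<in> lists A" for xs
    using that A(2) unfolding P_def by (induction xs) auto
  have Pa: "P (xs @ ys) = P xs \<otimes>\<^bsub>G\<^esub> P ys" if "xs \<in> lists A" "ys \<in> lists A" for xs ys
    using that(1)
  proof (induction xs)
    case Nil
    then show ?case using Pc[OF that(2)] by (simp add: P_def)
  next
    case (Cons x xs)
    have "P ((x # xs) @ ys) = x \<otimes>\<^bsub>G\<^esub> (P xs \<otimes>\<^bsub>G\<^esub> P ys)"
      using Cons.IH by (simp add: P_def)
    moreover have "P (x # xs) = x \<otimes>\<^bsub>G\<^esub> P xs" by (simp add: P_def)
    moreover have "x \<in> carrier G" using Cons.hyps A(2) by auto
    ultimately show ?case
      using Pc[OF that(2)] Pc[OF Cons.hyps(2)] by (simp add: m_assoc)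
  qed
  have "submonoid (P ` lists A) G"
  proof
    show "P ` lists A \<subseteq> carrier G" using Pc by auto
    show "x \<otimes>\<^bsub>G\<^esub> y \<in> P ` lists A" if "x \<in> P ` lists A" "y \<in> P ` lists A" for x y
    proof -
      from that obtain xs ys where "xs \<in> lists A" "ys \<in> lists A" "x = P xs" "y = P ys" by blast
      then show ?thesis using Pa[of xs ys] by (intro image_eqI[of _ _ "xs @ ys"]) auto
    qed
    show "\<one>\<^bsub>G\<^esub> \<in> P ` lists A" by (rule image_eqI[of _ _ "[]"]) (auto simp: P_def)
  qed
  moreover have "A \<subseteq> P ` lists A"
  proof
    fix a assume "a \<in> A"
    then show "a \<in> P ` lists A" using A(2) by (intro image_eqI[of _ _ "[a]"]) (auto simp: P_def)
  qed
  ultimately have "carrier G \<subseteq> P ` lists A"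
    using A(3) hull_minimal[of A "P ` lists A" "\<lambda>H. submonoid H G"] by simp
  moreover have "countable (P ` lists A)"
    using A(1) by (intro countable_image countable_lists countable_finite)
  ultimately show ?thesis by (rule countable_subset)
qed

lemma transfer_finiteI:
  fixes N :: "('b, 'n) monoid_scheme"
  assumes N: "comm_monoid_cancel N" "finitely_generated_monoid N"
    and \<theta>: "\<theta> \<in> transfer_hom (additive_monoid_on M) N"
  shows "transfer_finite M"
proof -
  interpret N: comm_monoid_cancel N by fact
  define f where "f = to_nat_on (carrier N)"
  define g where "g = from_nat_into (carrier N)"
  have cN: "countable (carrier N)"
    using finitely_generated_monoid_countable[OF N.monoid_axioms N(2)] .
  have gf [simp]: "g (f x) = x" if "x \<in> carrier N" for x
    using that cN by (simp add: f_def g_def)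
  have finj: "f x = f y \<longleftrightarrow> x = y" if "x \<in> carrier N" "y \<in> carrier N" for x y
    using gf that by metis
  define N' :: "nat monoid"
    where "N' = \<lparr>carrier = f ` carrier N, monoid.mult = (\<lambda>x y. f (g x \<otimes>\<^bsub>N\<^esub> g y)), monoid.one = f \<one>\<^bsub>N\<^esub>\<rparr>"
  have N'c: "carrier N' = f ` carrier N" and N'1: "\<one>\<^bsub>N'\<^esub> = f \<one>\<^bsub>N\<^esub>" by (simp_all add: N'_def)
  have N'm: "f x \<otimes>\<^bsub>N'\<^esub> f y = f (x \<otimes>\<^bsub>N\<^esub> y)" if "x \<in> carrier N" "y \<in> carrier N" for x y
    using that by (simp add: N'_def)
  have "comm_monoid N'"
    by (rule comm_monoidI) (auto simp: N'c N'1 N'm N.m_ac)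
  then have "comm_monoid_cancel N'"
    by (rule comm_monoid_cancelI) (auto simp: N'c N'm finj dest: N.r_cancel)
  moreover have "finitely_generated_monoid N'"
  proof -
    obtain A where A: "finite A" "A \<subseteq> carrier N" "(\<lambda>H. submonoid H N) hull A = carrier N"
      using N(2) unfolding finitely_generated_monoid_def by blast
    have "carrier N' \<subseteq> H" if H: "submonoid H N'" "f ` A \<subseteq> H" for H
    proof -
      interpret H: submonoid H N' by fact
      have "submonoid {x \<in> carrier N. f x \<in> H} N"
      proof
        fix x y assume "x \<in> {x \<in> carrier N. f x \<in> H}" "y \<in> {x \<in> carrier N. f x \<in> H}"
        then show "x \<otimes>\<^bsub>N\<^esub> y \<in> {x \<in> carrier N. f x \<in> H}"
          using H.m_closed[of "f x" "f y"] by (simp add: N'm)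
      next
        show "\<one>\<^bsub>N\<^esub> \<in> {x \<in> carrier N. f x \<in> H}" using H.one_closed by (simp add: N'1)
      qed auto
      moreover have "A \<subseteq> {x \<in> carrier N. f x \<in> H}" using A(2) H(2) by auto
      ultimately have "carrier N \<subseteq> {x \<in> carrier N. f x \<in> H}"
        using A(3) hull_minimal[of A _ "\<lambda>H. submonoid H N"] by metis
      then show ?thesis by (auto simp: N'c)
    qed
    moreover have "submonoid (carrier N') N'"
      by standard (auto simp: N'c N'm N'1)
    moreover have "f ` A \<subseteq> carrier N'" using A(2) by (auto simp: N'c)
    ultimately have "(\<lambda>H. submonoid H N') hull (f ` A) = carrier N'"
      by (intro hull_unique) auto
    with A(1) \<open>f ` A \<subseteq> carrier N'\<close> show ?thesis
      unfolding finitely_generated_monoid_def by blast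
  qed
  moreover have "(\<lambda>a. f (\<theta> a)) \<in> transfer_hom (additive_monoid_on M) N'"
  proof -
    let ?M = "additive_monoid_on M"
    have hom: "\<theta> \<in> hom ?M N" and one: "\<theta> \<one>\<^bsub>?M\<^esub> = \<one>\<^bsub>N\<^esub>"
      and T1: "carrier N = (\<theta> ` carrier ?M) <#>\<^bsub>N\<^esub> Units N"
      and T1': "{a \<in> carrier ?M. \<theta> a \<in> Units N} = Units ?M"
      and T2: "\<And>a b1 b2. \<lbrakk>a \<in> carrier ?M; b1 \<in> carrier N; b2 \<in> carrier N; \<theta> a = b1 \<otimes>\<^bsub>N\<^esub> b2\<rbrakk> \<Longrightarrow>
        \<exists>a1 \<in> carrier ?M. \<exists>a2 \<in> carrier ?M. a = a1 \<otimes>\<^bsub>?M\<^esub> a2 \<and> \<theta> a1 = b1 \<and> \<theta> a2 = b2"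
      using \<theta> unfolding transfer_hom_def monoid_hom_def by auto
    have c: "\<theta> a \<in> carrier N" if "a \<in> carrier ?M" for a
      using hom that by (auto simp: hom_def)
    have U: "Units N' = f ` Units N"
      by (auto simp: Units_def N'c N'm N'1 finj intro!: imageI)
    have Ui: "f x \<in> Units N' \<longleftrightarrow> x \<in> Units N" if "x \<in> carrier N" for x
      using that finj N.Units_closed by (auto simp: U)
    have "(\<lambda>a. f (\<theta> a)) \<in> hom ?M N'"
      using hom c by (auto simp: hom_def N'c N'm)
    moreover have "carrier N' = ((\<lambda>a. f (\<theta> a)) ` carrier ?M) <#>\<^bsub>N'\<^esub> Units N'"
    proof -
      have "((\<lambda>a. f (\<theta> a)) ` carrier ?M) <#>\<^bsub>N'\<^esub> Units N'
          = f ` ((\<theta> ` carrier ?M) <#>\<^bsub>N\<^esub> Units N)"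
        using c by (auto simp: set_mult_def U N'm N.Units_closed image_UN)
      then show ?thesis using T1 N'c by simp
    qed
    moreover have "{a \<in> carrier ?M. f (\<theta> a) \<in> Units N'} = Units ?M"
      using T1' c Ui by auto
    moreover have "\<exists>a1 \<in> carrier ?M. \<exists>a2 \<in> carrier ?M.
        a = a1 \<otimes>\<^bsub>?M\<^esub> a2 \<and> f (\<theta> a1) = b1 \<and> f (\<theta> a2) = b2"
      if ab: "a \<in> carrier ?M" "b1 \<in> carrier N'" "b2 \<in> carrier N'" "f (\<theta> a) = b1 \<otimes>\<^bsub>N'\<^esub> b2"
      for a b1 b2
    proof -
      obtain y1 y2 where y: "y1 \<in> carrier N" "y2 \<in> carrier N" "b1 = f y1" "b2 = f y2"
        using ab by (auto simp: N'c)
      then have "\<theta> a = y1 \<otimes>\<^bsub>N\<^esub> y2" using ab c by (simp add: N'm finj)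
      from T2[OF ab(1) y(1,2) this] show ?thesis using y by auto
    qed
    ultimately show ?thesis
      unfolding transfer_hom_def monoid_hom_def using one N'1 by auto
  qed
  ultimately show ?thesis unfolding transfer_finite_def by blast
qed

end

theory Submission
  imports Defs
begin

text \<open>
  The key observation is that an element \<open>t\<close> of infinite order in a finitely generated
  cancellative monoid \<open>F\<close> is not divisible by arbitrarily large integers. It is captured by
  an additive map \<open>\<phi>: F \<rightarrow> \<rat>\<close> with \<open>\<phi> t = 1\<close>. Such a map exists
  (\<open>ex_additive_character_nonzero\<close>) because \<open>\<rat>\<close> is divisible: start with
  \<open>n t \<mapsto> n\<close> and extend over the generators of \<open>F\<close> one by one. Since \<open>F\<close> has finitely
  many generators, the values of \<open>\<phi>\<close> have a common denominator.

  Now let \<open>\<theta>: M \<rightarrow> F\<close> have trivial kernel, and take \<open>z \<in> M\<close> nonzero. As no positive multiple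
  of \<open>z\<close> is mapped to the identity, \<open>\<theta> z\<close> has infinite order and there is such a \<open>\<phi>\<close> for
  \<open>t = \<theta> z\<close>. An additive map from \<open>M \<subseteq> \<rat>\<close> to \<open>\<rat>\<close> is multiplication by a constant, so
  \<open>\<phi> (\<theta> x) = x / z\<close>, and the common denominator of \<open>\<phi>\<close> places \<open>M\<close> inside \<open>c \<nat>\<close> for
  some \<open>c > 0\<close>. Taking for the scale the least positive difference of two elements of \<open>M\<close>
  turns \<open>M\<close> into a submonoid of \<open>\<nat>\<close> that contains two consecutive numbers, which is a
  numerical monoid (\<open>isomorphic_to_numerical_monoidI\<close>).

  For the second claim, \<open>0\<close> is the only unit of \<open>M\<close>, so every transfer homomorphism on \<open>M\<close> has
  trivial kernel and the first claim applies. Conversely, a numerical monoid is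
  finitely generated, and an isomorphism onto it is a transfer homomorphism.
\<close>

section \<open>Additive characters of cancellative monoids\<close>

definition additive_character_on ::
  "('a, 'm) monoid_scheme \<Rightarrow> 'a set \<Rightarrow> ('a \<Rightarrow> 'k::field_char_0) \<Rightarrow> bool" where
  "additive_character_on G H \<phi> \<longleftrightarrow>
     submonoid H G \<and> (\<forall>x\<in>H. \<forall>y\<in>H. \<phi> (x \<otimes>\<^bsub>G\<^esub> y) = \<phi> x + \<phi> y)"

lemma additive_character_onD:
  assumes "additive_character_on G H \<phi>"
  shows "submonoid H G" and "x \<in> H \<Longrightarrow> y \<in> H \<Longrightarrow> \<phi> (x \<otimes>\<^bsub>G\<^esub> y) = \<phi> x + \<phi> y"
  using assms by (auto simp: additive_character_on_def)

lemma (in monoid) submonoid_nat_pow_closed: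
  assumes "submonoid H G" and "x \<in> H"
  shows "x [^] (n::nat) \<in> H"
  using assms by (induction n) (auto simp: submonoid.one_closed submonoid.m_closed)

lemma (in monoid) additive_character_one:
  assumes "additive_character_on G H \<phi>"
  shows "\<phi> \<one> = 0"
  using additive_character_onD(2)[OF assms, of \<one> \<one>]
    submonoid.one_closed[OF additive_character_onD(1)[OF assms]] by simp

lemma (in monoid) additive_character_nat_pow:
  assumes "additive_character_on G H \<phi>" and "x \<in> H"
  shows "\<phi> (x [^] (n::nat)) = of_nat n * \<phi> x"
proof (induction n)
  case 0
  show ?case using additive_character_one[OF assms(1)] by simp
next
  case (Suc n)
  have "\<phi> (x [^] n \<otimes> x) = \<phi> (x [^] n) + \<phi> x"
    using submonoid_nat_pow_closed[OF additive_character_onD(1)[OF assms(1)] assms(2)] assms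
    by (simp add: additive_character_onD(2))
  then show ?case using Suc.IH by (simp add: algebra_simps)
qed

text \<open>
  The number \<open>q\<close> is the value to be assigned to the new generator \<open>a\<close>. If some positive power of
  \<open>a\<close> is a quotient of two elements of \<open>H\<close>, one such relation determines \<open>q\<close> by
  division, and any other relation agrees with it by elimination of \<open>a\<close>. If there is no
  relation, every \<open>q\<close> will do.
\<close>

lemma (in comm_monoid_cancel) ex_slope_for_new_generator:
  fixes \<phi> :: "'a \<Rightarrow> 'k::field_char_0"
  assumes \<phi>: "additive_character_on G H \<phi>" and a: "a \<in> carrier G"
  obtains q where "\<And>h h' k. \<lbrakk>h \<in> H; h' \<in> H; h = h' \<otimes> a [^] (k::nat)\<rbrakk> \<Longrightarrow> \<phi> h = \<phi> h' + of_nat k * q"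
proof (cases "\<exists>h\<in>H. \<exists>h'\<in>H. \<exists>k::nat. 0 < k \<and> h = h' \<otimes> a [^] k")
  case False
  have "\<phi> h = \<phi> h' + of_nat k * 0" if "h \<in> H" "h' \<in> H" "h = h' \<otimes> a [^] (k::nat)" for h h' k
  proof -
    have "\<not> 0 < k"
    proof
      assume "0 < k"
      with that(3) have "\<exists>k::nat. 0 < k \<and> h = h' \<otimes> a [^] k" by (intro exI[of _ k]) simp
      with that(1,2) have "\<exists>h\<in>H. \<exists>h'\<in>H. \<exists>k::nat. 0 < k \<and> h = h' \<otimes> a [^] k"
        by (intro bexI[of _ h] bexI[of _ h'])
      with False show False by (rule notE)
    qed
    then have "k = 0" by simp
    then show ?thesis
      using that submonoid.mem_carrier[OF additive_character_onD(1)[OF \<phi>]] by simp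
  qed
  then show thesis by (rule that)
next
  case True
  interpret H: submonoid H G by (rule additive_character_onD(1)[OF \<phi>])
  note HG = H.mem_carrier and pow = submonoid_nat_pow_closed[OF H.submonoid_axioms]
  obtain h0 h0' and k0 :: nat where 0: "h0 \<in> H" "h0' \<in> H" "0 < k0" "h0 = h0' \<otimes> a [^] k0"
    using True by (elim bexE exE conjE)
  define q where "q = (\<phi> h0 - \<phi> h0') / of_nat k0"
  have "\<phi> h = \<phi> h' + of_nat k * q" if h: "h \<in> H" "h' \<in> H" "h = h' \<otimes> a [^] (k::nat)" for h h' k
  proof -
    have 1: "h0 [^] k = h0' [^] k \<otimes> a [^] (k0 * k)"
      using 0 a HG by (simp add: nat_pow_distrib nat_pow_pow)
    have 2: "h [^] k0 = h' [^] k0 \<otimes> a [^] (k0 * k)"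
      using h a HG by (simp add: nat_pow_distrib nat_pow_pow mult.commute)
    \<comment> \<open>Both relations, raised so that \<open>a\<close> occurs with the exponent \<open>k0 * k\<close>, eliminate \<open>a\<close>.\<close>
    have "h0 [^] k \<otimes> h' [^] k0 = h0' [^] k \<otimes> h [^] k0"
      unfolding 1 2 using 0(2) h(2) a HG by (simp add: m_ac)
    then have "\<phi> (h0 [^] k \<otimes> h' [^] k0) = \<phi> (h0' [^] k \<otimes> h [^] k0)" by simp
    then have "of_nat k * (\<phi> h0 - \<phi> h0') = of_nat k0 * (\<phi> h - \<phi> h')"
      using 0 h pow by (simp add: additive_character_onD(2)[OF \<phi>]
          additive_character_nat_pow[OF \<phi>] algebra_simps)
    then show ?thesis using 0(3) by (simp add: q_def field_simps)
  qed
  then show thesis by (rule that)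
qed

text \<open>
  The extension is \<open>\<psi> (h \<otimes> a [^] n) = \<phi> h + n q\<close> on the submonoid of all
  \<open>h \<otimes> a [^] n\<close>. Cancelling the smaller power of \<open>a\<close> reduces its well-definedness to the
  defining property of the slope \<open>q\<close>.
\<close>

lemma (in comm_monoid_cancel) additive_character_extend_generator:
  fixes \<phi> :: "'a \<Rightarrow> 'k::field_char_0"
  assumes \<phi>: "additive_character_on G H \<phi>" and a: "a \<in> carrier G"
  obtains H' \<psi> where "additive_character_on G H' \<psi>" "H \<subseteq> H'" "a \<in> H'" "\<And>x. x \<in> H \<Longrightarrow> \<psi> x = \<phi> x"
proof -
  interpret H: submonoid H G by (rule additive_character_onD(1)[OF \<phi>])
  note HG = H.mem_carrier
  obtain q where q: "\<And>h h' k. \<lbrakk>h \<in> H; h' \<in> H; h = h' \<otimes> a [^] (k::nat)\<rbrakk> \<Longrightarrow> \<phi> h = \<phi> h' + of_nat k * q"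
    using ex_slope_for_new_generator[OF \<phi> a] by blast
  have le: "\<phi> h + of_nat n * q = \<phi> h' + of_nat m * q"
    if "h \<in> H" "h' \<in> H" "h \<otimes> a [^] n = h' \<otimes> a [^] m" "n \<le> m" for h h' and n m :: nat
  proof -
    have "a [^] (m - n) \<otimes> a [^] n = a [^] m"
      using a that(4) by (simp add: nat_pow_mult)
    then have "h \<otimes> a [^] n = (h' \<otimes> a [^] (m - n)) \<otimes> a [^] n"
      using that HG a by (simp add: m_assoc)
    then have "h = h' \<otimes> a [^] (m - n)"
      using that HG a by (meson m_closed nat_pow_closed r_cancel)
    from q[OF that(1,2) this] show ?thesis using that(4) by (simp add: of_nat_diff algebra_simps)
  qed
  have wd: "\<phi> h + of_nat n * q = \<phi> h' + of_nat m * q"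
    if "h \<in> H" "h' \<in> H" "h \<otimes> a [^] n = h' \<otimes> a [^] m" for h h' and n m :: nat
    using le[OF that] le[OF that(2,1) that(3)[symmetric]] by (cases "n \<le> m") auto
  define H' where "H' = {h \<otimes> a [^] n | h n::nat. h \<in> H}"
  define \<psi> where "\<psi> y = (THE v. \<exists>h\<in>H. \<exists>n::nat. y = h \<otimes> a [^] n \<and> v = \<phi> h + of_nat n * q)" for y
  have \<psi>: "\<psi> (h \<otimes> a [^] n) = \<phi> h + of_nat n * q" if "h \<in> H" for h and n :: nat
    unfolding \<psi>_def
  proof (rule the_equality)
    show "\<exists>h'\<in>H. \<exists>m::nat. h \<otimes> a [^] n = h' \<otimes> a [^] m \<and> \<phi> h + of_nat n * q = \<phi> h' + of_nat m * q"
      using that by blast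
    show "v = \<phi> h + of_nat n * q"
      if v: "\<exists>h'\<in>H. \<exists>m::nat. h \<otimes> a [^] n = h' \<otimes> a [^] m \<and> v = \<phi> h' + of_nat m * q" for v
      using v wd[OF \<open>h \<in> H\<close>] by metis
  qed
  have mult: "(h \<otimes> a [^] n) \<otimes> (h' \<otimes> a [^] m) = (h \<otimes> h') \<otimes> a [^] (n + m)"
    if "h \<in> H" "h' \<in> H" for h h' and n m :: nat
    using that HG a by (simp add: m_ac nat_pow_mult[symmetric])
  have mem: "h \<otimes> a [^] n \<in> H'" if "h \<in> H" for h and n :: nat
    using that by (auto simp: H'_def)
  have emb: "h = h \<otimes> a [^] (0::nat)" if "h \<in> H" for h
    using that HG by simp
  show thesis
  proof (rule that)
    have "submonoid H' G"
    proof
      show "H' \<subseteq> carrier G" using HG a by (auto simp: H'_def)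
      show "\<one> \<in> H'" using mem[OF H.one_closed, of 0] by simp
      show "x \<otimes> y \<in> H'" if "x \<in> H'" "y \<in> H'" for x y
        using that mult by (fastforce simp: H'_def)
    qed
    moreover have "\<psi> (x \<otimes> y) = \<psi> x + \<psi> y" if "x \<in> H'" "y \<in> H'" for x y
    proof -
      from that obtain h h' and n m :: nat
        where "h \<in> H" "h' \<in> H" "x = h \<otimes> a [^] n" "y = h' \<otimes> a [^] m"
        unfolding H'_def by blast
      then show ?thesis
        by (simp add: mult \<psi> additive_character_onD(2)[OF \<phi>] algebra_simps)
    qed
    ultimately show "additive_character_on G H' \<psi>" by (simp add: additive_character_on_def)
    show "H \<subseteq> H'" using emb mem by (metis subsetI)
    show "a \<in> H'" using mem[OF H.one_closed, of 1] a by simp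
    show "\<psi> x = \<phi> x" if "x \<in> H" for x
      using \<psi>[OF that, of 0] emb[OF that] by simp
  qed
qed

lemma (in comm_monoid_cancel) additive_character_extend_finite:
  fixes \<phi> :: "'a \<Rightarrow> 'k::field_char_0"
  assumes "additive_character_on G H \<phi>" and "finite A" and "A \<subseteq> carrier G"
  shows "\<exists>H' \<psi>. additive_character_on G H' \<psi> \<and> H \<union> A \<subseteq> H' \<and> (\<forall>x\<in>H. \<psi> x = \<phi> x)"
  using assms(2,3)
proof (induction A rule: finite_induct)
  case empty
  show ?case using assms(1) by blast
next
  case (insert a A)
  then obtain H' \<psi> where 1: "additive_character_on G H' \<psi>" "H \<union> A \<subseteq> H'" "\<forall>x\<in>H. \<psi> x = \<phi> x"
    by auto
  obtain H'' \<chi> where "additive_character_on G H'' \<chi>" "H' \<subseteq> H''" "a \<in> H''" "\<And>x. x \<in> H' \<Longrightarrow> \<chi> x = \<psi> x"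
    using additive_character_extend_generator[OF 1(1), of a] insert.prems by blast
  with 1 show ?case by (intro exI[of _ H''] exI[of _ \<chi>]) auto
qed

lemma submonoid_contains_generated:
  assumes "(\<lambda>H. submonoid H G) hull A = carrier G" and "submonoid H G" and "A \<subseteq> H"
  shows "carrier G \<subseteq> H"
  using assms hull_minimal[of A H "\<lambda>H. submonoid H G"] by simp

text \<open>
  On the powers of \<open>t\<close> the character is \<open>t [^] n \<mapsto> n\<close>, which is well defined because \<open>t\<close> has
  infinite order in a cancellative monoid; extending it over a finite generating set reaches
  all of the monoid.
\<close>

lemma (in comm_monoid_cancel) ex_additive_character_nonzero:
  assumes fg: "finitely_generated_monoid G" and t: "t \<in> carrier G"
    and ord: "\<And>n::nat. 0 < n \<Longrightarrow> t [^] n \<noteq> \<one>"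
  obtains \<phi> :: "'a \<Rightarrow> 'k::field_char_0" where "additive_character_on G (carrier G) \<phi>" "\<phi> t = 1"
proof -
  obtain A where A: "finite A" "A \<subseteq> carrier G" "(\<lambda>H. submonoid H G) hull A = carrier G"
    using fg unfolding finitely_generated_monoid_def by blast
  define T where "T = range (\<lambda>n::nat. t [^] n)"
  have inj: "n = m" if "t [^] n = t [^] m" for n m :: nat
  proof -
    have *: "n = m" if "n \<le> m" "t [^] n = t [^] m" for n m :: nat
    proof -
      have "t [^] n \<otimes> t [^] (m - n) = t [^] m"
        using that(1) t by (simp add: nat_pow_mult)
      then have "t [^] n \<otimes> t [^] (m - n) = t [^] n \<otimes> \<one>" using that(2) t by simp
      then have "t [^] (m - n) = \<one>" using t by (metis l_cancel nat_pow_closed one_closed)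
      then show ?thesis using ord[of "m - n"] that(1) by fastforce
    qed
    show ?thesis using *[of n m] *[of m n] that by (cases "n \<le> m") auto
  qed
  define \<tau> :: "'a \<Rightarrow> 'k" where "\<tau> x = of_nat (the_inv (\<lambda>n::nat. t [^] n) x)" for x
  have \<tau>: "\<tau> (t [^] n) = of_nat n" for n :: nat
    unfolding \<tau>_def using inj by (subst the_inv_f_f) (auto intro: injI)
  have "submonoid T G"
  proof
    show "\<one> \<in> T" unfolding T_def by (rule image_eqI[of _ _ 0]) auto
    show "x \<otimes> y \<in> T" if "x \<in> T" "y \<in> T" for x y
      using that t by (auto simp: T_def nat_pow_mult)
  qed (use t in \<open>auto simp: T_def\<close>)
  then have "additive_character_on G T \<tau>"
    unfolding additive_character_on_def using t by (auto simp: T_def nat_pow_mult \<tau>)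
  from additive_character_extend_finite[OF this A(1,2)] obtain H and \<psi> :: "'a \<Rightarrow> 'k"
    where H: "additive_character_on G H \<psi>" "T \<union> A \<subseteq> H" "\<forall>x\<in>T. \<psi> x = \<tau> x" by blast
  have "H = carrier G"
    using submonoid_contains_generated[OF A(3) additive_character_onD(1)[OF H(1)]]
      submonoid.subset[OF additive_character_onD(1)[OF H(1)]] H(2) by auto
  moreover have "t = t [^] (1::nat)" using t by simp
  then have "t \<in> T" and "\<tau> t = 1" using \<tau>[of 1] unfolding T_def by (blast, simp)
  ultimately show thesis using H that by auto
qed

lemma ex_common_denominator:
  fixes f :: "'a \<Rightarrow> rat"
  assumes "finite A"
  obtains D :: nat where "0 < D" "\<And>a. a \<in> A \<Longrightarrow> of_nat D * f a \<in> \<int>"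
proof -
  have "\<exists>D>0. \<forall>a\<in>A. of_nat D * f a \<in> \<int>" using assms
  proof (induction A rule: finite_induct)
    case (insert a A)
    then obtain D where D: "0 < D" "\<forall>a\<in>A. of_nat D * f a \<in> \<int>" by blast
    obtain p q where pq: "quotient_of (f a) = (p, q)" by fastforce
    then have q: "0 < q" "f a = of_int p / of_int q"
      using quotient_of_denom_pos quotient_of_div by blast+
    have e: "of_nat (nat q * D) = (of_int q * of_nat D :: rat)" using q by simp
    have "of_nat (nat q * D) * f x \<in> \<int>" if "x \<in> insert a A" for x
    proof (cases "x = a")
      case True
      then have "of_nat (nat q * D) * f x = of_int (p * int D)" unfolding e using q by simp
      then show ?thesis by (metis Ints_of_int)
    next
      case False
      then have "of_nat D * f x \<in> \<int>" using D(2) that by blast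
      then have "of_int q * (of_nat D * f x) \<in> \<int>" by (rule Ints_mult[OF Ints_of_int])
      then show ?thesis unfolding e mult.assoc .
    qed
    then show ?case using q D(1) by (intro exI[of _ "nat q * D"]) auto
  qed auto
  then show thesis using that by blast
qed

text \<open>
  A common denominator for the generators serves all elements, since those with integral value
  of \<open>D \<phi>\<close> form a submonoid.
\<close>

lemma (in monoid) additive_character_bounded_denominator:
  fixes \<phi> :: "'a \<Rightarrow> rat"
  assumes fg: "finitely_generated_monoid G" and \<phi>: "additive_character_on G (carrier G) \<phi>"
  obtains D :: nat where "0 < D" "\<And>x. x \<in> carrier G \<Longrightarrow> of_nat D * \<phi> x \<in> \<int>"
proof -
  obtain A where A: "finite A" "A \<subseteq> carrier G" "(\<lambda>H. submonoid H G) hull A = carrier G"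
    using fg unfolding finitely_generated_monoid_def by blast
  obtain D :: nat where D: "0 < D" "\<And>a. a \<in> A \<Longrightarrow> of_nat D * \<phi> a \<in> \<int>"
    using ex_common_denominator[OF A(1)] by blast
  have "submonoid {x \<in> carrier G. of_nat D * \<phi> x \<in> \<int>} G"
    by standard (auto simp: additive_character_onD(2)[OF \<phi>] additive_character_one[OF \<phi>] distrib_left)
  from submonoid_contains_generated[OF A(3) this] D A(2)
  have "carrier G \<subseteq> {x \<in> carrier G. of_nat D * \<phi> x \<in> \<int>}" by blast
  then show thesis using D(1) that by blast
qed

section \<open>Puiseux monoids\<close>

lemma additive_monoid_on_simps [simp]:
  "carrier (additive_monoid_on S) = S"
  "x \<otimes>\<^bsub>additive_monoid_on S\<^esub> y = x + y"
  "\<one>\<^bsub>additive_monoid_on S\<^esub> = 0"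
  by (simp_all add: additive_monoid_on_def)

lemma puiseux_monoidD:
  assumes "puiseux_monoid M"
  shows "x \<in> M \<Longrightarrow> 0 \<le> x" "0 \<in> M" "x \<in> M \<Longrightarrow> y \<in> M \<Longrightarrow> x + y \<in> M"
proof -
  interpret submonoid M "additive_monoid_on {q. 0 \<le> q}"
    using assms by (simp add: puiseux_monoid_def)
  show "x \<in> M \<Longrightarrow> 0 \<le> x" "0 \<in> M" "x \<in> M \<Longrightarrow> y \<in> M \<Longrightarrow> x + y \<in> M"
    using subset one_closed m_closed by auto
qed

lemma puiseux_monoid_of_nat_mult:
  assumes "puiseux_monoid M" and "x \<in> M"
  shows "of_nat n * x \<in> M"
  using puiseux_monoidD[OF assms(1)] assms(2) by (induction n) (auto simp: algebra_simps)

text \<open>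
  Any two nonzero elements of a Puiseux monoid have a common positive integer multiple, and
  comparing the two expressions for its value under \<open>f\<close> shows that \<open>f x / x\<close> does not depend
  on \<open>x\<close>.
\<close>

lemma additive_on_puiseux_monoid_linear:
  fixes f :: "rat \<Rightarrow> rat"
  assumes M: "puiseux_monoid M"
    and f: "\<And>x y. x \<in> M \<Longrightarrow> y \<in> M \<Longrightarrow> f (x + y) = f x + f y"
    and x: "x \<in> M" and y: "y \<in> M"
  shows "f x * y = f y * x"
proof (cases "x = 0 \<or> y = 0")
  case True
  have "f 0 = 0" using f[of 0 0] puiseux_monoidD(2)[OF M] by simp
  then show ?thesis using True by auto
next
  case False
  have fn: "f (of_nat n * z) = of_nat n * f z" if "z \<in> M" for n z
  proof (induction n)
    case 0
    show ?case using f[of 0 0] puiseux_monoidD(2)[OF M] by simp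
  next
    case (Suc n)
    then show ?case
      using f[OF that puiseux_monoid_of_nat_mult[OF M that, of n]] by (simp add: algebra_simps)
  qed
  have pos: "0 < x / y" using False puiseux_monoidD(1)[OF M] x y by (simp add: less_le)
  obtain p q where pq: "quotient_of (x / y) = (p, q)" by fastforce
  then have q: "0 < q" "x / y = of_int p / of_int q"
    using quotient_of_denom_pos quotient_of_div by blast+
  then have p: "0 < p" using pos by (simp add: zero_less_divide_iff)
  have eq: "of_nat (nat q) * x = of_nat (nat p) * y"
    using p q False by (simp add: field_simps)
  then have "of_nat (nat q) * f x = of_nat (nat p) * f y"
    using fn[OF x, of "nat q"] fn[OF y, of "nat p"] by simp
  then have "of_nat (nat q) * (f x * y) = f y * (of_nat (nat p) * y)"
    by (simp add: mult.assoc[symmetric])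
  also have "\<dots> = of_nat (nat q) * (f y * x)" unfolding eq[symmetric] by simp
  finally show ?thesis using q by simp
qed

text \<open>
  The differences of elements of \<open>M\<close> form a nontrivial subgroup of \<open>c \<int>\<close>; the new scale is
  its least positive element, which generates it and is by choice the difference of
  two elements of \<open>M\<close>. In the proof \<open>d\<close> counts this scale in units of \<open>c\<close>.
\<close>

lemma ex_finest_scale:
  assumes M: "puiseux_monoid M" "M \<noteq> {0}"
    and c: "0 < c" "\<And>x. x \<in> M \<Longrightarrow> \<exists>n::nat. x = of_nat n * c"
  obtains d :: rat and s :: nat where "0 < d" "\<And>x. x \<in> M \<Longrightarrow> \<exists>n::nat. x = of_nat n * d"
    "of_nat s * d \<in> M" "of_nat (Suc s) * d \<in> M"
proof -
  note MD = puiseux_monoidD[OF M(1)]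
  define P where "P n \<longleftrightarrow> 0 < n \<and> (\<exists>x\<in>M. x + of_nat n * c \<in> M)" for n :: nat
  obtain z where z: "z \<in> M" "z \<noteq> 0" using M MD(2) by blast
  then obtain k :: nat where "z = of_nat k * c" using c(2) by blast
  then have "P k" using z MD(2) by (auto simp: P_def intro!: bexI[of _ 0] gr0I)
  define d where "d = (LEAST n. P n)"
  have d: "P d" and least: "\<And>n. P n \<Longrightarrow> d \<le> n"
    unfolding d_def using \<open>P k\<close> by (auto intro: LeastI Least_le)
  obtain x where x: "x \<in> M" "x + of_nat d * c \<in> M" and d0: "0 < d" using d by (auto simp: P_def)
  have dvd: "d dvd n" if n: "of_nat n * c \<in> M" for n
  proof (rule ccontr)
    assume "\<not> d dvd n"
    then have "0 < n mod d" by (simp add: mod_greater_zero_iff_not_dvd)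
    \<comment> \<open>The remainder is again a difference of two elements: add
        \<open>n div d\<close> copies of \<open>x + d * c\<close> on one side and of \<open>x\<close> on the other.\<close>
    moreover have "of_nat (n div d) * (x + of_nat d * c) + of_nat (n mod d) * c
        = of_nat (n div d) * x + of_nat n * c"
    proof -
      have "(of_nat n :: rat) = of_nat (n div d) * of_nat d + of_nat (n mod d)"
        by (metis div_mult_mod_eq of_nat_add of_nat_mult)
      then show ?thesis by (simp add: algebra_simps)
    qed
    then have "of_nat (n div d) * (x + of_nat d * c) + of_nat (n mod d) * c \<in> M"
      using MD(3)[OF puiseux_monoid_of_nat_mult[OF M(1) x(1)] n] by simp
    ultimately have "P (n mod d)"
      unfolding P_def using puiseux_monoid_of_nat_mult[OF M(1) x(2)] by blast
    then show False using least[of "n mod d"] mod_less_divisor[OF d0, of n] by simp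
  qed
  have scale: "\<exists>n::nat. y = of_nat n * (of_nat d * c)" if "y \<in> M" for y
  proof -
    obtain m :: nat where m: "y = of_nat m * c" using c(2) \<open>y \<in> M\<close> by blast
    then have "d dvd m" using dvd that by simp
    then obtain n where "m = d * n" by blast
    with m show ?thesis by (intro exI[of _ n]) simp
  qed
  obtain s :: nat where s: "x = of_nat s * (of_nat d * c)" using scale[OF x(1)] by blast
  show thesis
  proof (rule that[of "of_nat d * c" s])
    show "of_nat s * (of_nat d * c) \<in> M" using x(1) s by simp
    show "of_nat (Suc s) * (of_nat d * c) \<in> M" using x(2) s by (simp add: algebra_simps)
  qed (use d0 c(1) scale in auto)
qed

text \<open>
  For \<open>s > 0\<close>, every \<open>n \<ge> s\<^sup>2\<close> has a quotient by \<open>s\<close> that is at least its remainder \<open>r\<close>, so \<open>r\<close> of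
  the summands \<open>s\<close> can be replaced by \<open>s + 1\<close> to make up for the remainder. For \<open>s = 0\<close> the
  number \<open>1\<close> lies in \<open>S\<close>.
\<close>

lemma finite_compl_if_consecutive:
  fixes S :: "nat set"
  assumes "0 \<in> S" and add: "\<And>x y. x \<in> S \<Longrightarrow> y \<in> S \<Longrightarrow> x + y \<in> S"
    and s: "s \<in> S" "Suc s \<in> S"
  shows "finite (- S)"
proof -
  have mult: "k * x \<in> S" if "x \<in> S" for k x
    using that assms(1) by (induction k) (auto intro: add)
  have "n \<in> S" if "s * s \<le> n" for n
  proof (cases "s = 0")
    case True
    then show ?thesis using mult[of "Suc 0" n] s(2) by simp
  next
    case False
    have "n mod s < s" using False by simp
    moreover have "s \<le> n div s" using that False by (simp add: less_eq_div_iff_mult_less_eq)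
    ultimately have le: "n mod s \<le> n div s" by linarith
    have "n = (n div s) * s + n mod s" by simp
    also have "\<dots> = (n div s - n mod s) * s + (n mod s) * Suc s"
      using le by (simp add: diff_mult_distrib)
    finally have "n = (n div s - n mod s) * s + (n mod s) * Suc s" .
    then show ?thesis using add[OF mult[OF s(1)] mult[OF s(2)]] by metis
  qed
  then have "- S \<subseteq> {..<s * s}" by (auto simp: not_le[symmetric])
  then show ?thesis by (rule finite_subset) simp
qed

lemma isomorphic_to_numerical_monoidI:
  assumes M: "puiseux_monoid M" "M \<noteq> {0}"
    and c: "0 < c" "\<And>x. x \<in> M \<Longrightarrow> \<exists>n::nat. x = of_nat n * c"
  shows "isomorphic_to_numerical_monoid M"
proof -
  note MD = puiseux_monoidD[OF M(1)]
  obtain d :: rat and s :: nat where d: "0 < d" "\<And>x. x \<in> M \<Longrightarrow> \<exists>n::nat. x = of_nat n * d"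
    and s: "of_nat s * d \<in> M" "of_nat (Suc s) * d \<in> M"
    using ex_finest_scale[OF M c] by blast
  define S where "S = {n::nat. of_nat n * d \<in> M}"
  have Sadd: "x + y \<in> S" if "x \<in> S" "y \<in> S" for x y
    using that MD(2,3) by (auto simp: S_def algebra_simps)
  have S0: "0 \<in> S" using MD(2) by (simp add: S_def)
  have "submonoid S (additive_monoid_on UNIV)" by standard (auto simp: S0 Sadd)
  moreover have "finite (- S)"
    by (rule finite_compl_if_consecutive[OF S0 Sadd]) (use s in \<open>auto simp: S_def\<close>)
  ultimately have "numerical_monoid S" by (simp add: numerical_monoid_def)
  moreover have "additive_monoid_on M \<cong> additive_monoid_on S"
  proof -
    have g: "nat \<lfloor>of_nat n * d / d\<rfloor> = n" for n using d(1) by simp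
    have pre: "\<exists>n\<in>S. x = of_nat n * d" if "x \<in> M" for x
      using d(2)[OF that] that by (auto simp: S_def)
    have add: "nat \<lfloor>(of_nat n * d + of_nat m * d) / d\<rfloor> = n + m" for n m
      using g[of "n + m"] by (simp only: of_nat_add distrib_right)
    have "bij_betw (\<lambda>x. nat \<lfloor>x / d\<rfloor>) M S"
    proof (rule bij_betw_byWitness[where f' = "\<lambda>n. of_nat n * d"])
      show "\<forall>x\<in>M. of_nat (nat \<lfloor>x / d\<rfloor>) * d = x" using pre g by metis
      show "(\<lambda>x. nat \<lfloor>x / d\<rfloor>) ` M \<subseteq> S" using pre g by fastforce
    qed (use g in \<open>auto simp: S_def\<close>)
    moreover have "nat \<lfloor>(x + y) / d\<rfloor> = nat \<lfloor>x / d\<rfloor> + nat \<lfloor>y / d\<rfloor>" if "x \<in> M" "y \<in> M" for x y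
      using pre[OF that(1)] pre[OF that(2)] add g by metis
    ultimately show ?thesis
      by (intro is_isoI) (auto simp: iso_def hom_def bij_betw_def)
  qed
  ultimately show ?thesis
    unfolding isomorphic_to_numerical_monoid_def by blast
qed

lemma trivial_kernel_imp_isomorphic_to_numerical_monoid:
  fixes F :: "('b, 'm) monoid_scheme"
  assumes M: "puiseux_monoid M" "M \<noteq> {0}"
    and F: "comm_monoid_cancel F" "finitely_generated_monoid F"
    and \<theta>: "\<theta> \<in> monoid_hom (additive_monoid_on M) F"
    and ker: "{x \<in> M. \<theta> x = \<one>\<^bsub>F\<^esub>} = {0}"
  shows "isomorphic_to_numerical_monoid M"
proof -
  interpret F: comm_monoid_cancel F by (rule F(1))
  note MD = puiseux_monoidD[OF M(1)]
  have \<theta>c: "\<theta> x \<in> carrier F" if "x \<in> M" for x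
    using \<theta> that by (auto simp: monoid_hom_def hom_def)
  have \<theta>add: "\<theta> (x + y) = \<theta> x \<otimes>\<^bsub>F\<^esub> \<theta> y" if "x \<in> M" "y \<in> M" for x y
    using \<theta> that by (auto simp: monoid_hom_def hom_def)
  have \<theta>0: "\<theta> 0 = \<one>\<^bsub>F\<^esub>" using \<theta> by (simp add: monoid_hom_def)
  obtain z where z: "z \<in> M" "z \<noteq> 0" using M MD(2) by blast
  have z0: "0 < z" using MD(1)[OF z(1)] z(2) by simp
  have pow: "\<theta> (of_nat n * z) = \<theta> z [^]\<^bsub>F\<^esub> n" for n :: nat
  proof (induction n)
    case (Suc n)
    have "\<theta> (of_nat n * z + z) = \<theta> z [^]\<^bsub>F\<^esub> n \<otimes>\<^bsub>F\<^esub> \<theta> z"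
      using \<theta>add[OF puiseux_monoid_of_nat_mult[OF M(1) z(1)] z(1)] Suc by simp
    then show ?case by (simp add: algebra_simps)
  qed (simp add: \<theta>0)
  have "\<theta> z [^]\<^bsub>F\<^esub> n \<noteq> \<one>\<^bsub>F\<^esub>" if "0 < n" for n :: nat
  proof
    assume "\<theta> z [^]\<^bsub>F\<^esub> n = \<one>\<^bsub>F\<^esub>"
    then have "of_nat n * z \<in> {x \<in> M. \<theta> x = \<one>\<^bsub>F\<^esub>}"
      using puiseux_monoid_of_nat_mult[OF M(1) z(1)] pow by simp
    then show False unfolding ker using that z(2) by simp
  qed
  then obtain \<phi> :: "'b \<Rightarrow> rat" where \<phi>: "additive_character_on F (carrier F) \<phi>" "\<phi> (\<theta> z) = 1"
    using F.ex_additive_character_nonzero[OF F(2) \<theta>c[OF z(1)]] by blast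
  obtain D :: nat where D: "0 < D" "\<And>x. x \<in> carrier F \<Longrightarrow> of_nat D * \<phi> x \<in> \<int>"
    using F.additive_character_bounded_denominator[OF F(2) \<phi>(1)] by blast
  have "\<exists>n::nat. x = of_nat n * (z / of_nat D)" if x: "x \<in> M" for x
  proof -
    have "\<phi> (\<theta> x) * z = \<phi> (\<theta> z) * x"
      by (rule additive_on_puiseux_monoid_linear[OF M(1) _ x z(1), of "\<lambda>x. \<phi> (\<theta> x)"])
        (simp add: \<theta>add \<theta>c additive_character_onD(2)[OF \<phi>(1)])
    then have xz: "\<phi> (\<theta> x) = x / z" using \<phi>(2) z(2) by (simp add: field_simps)
    obtain k where k: "of_nat D * \<phi> (\<theta> x) = of_int k" using D(2)[OF \<theta>c[OF x]] by (auto elim: Ints_cases)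
    have "0 \<le> of_nat D * \<phi> (\<theta> x)" using xz z0 MD(1)[OF x] by simp
    then have "0 \<le> k" unfolding k by simp
    then have "of_nat (nat k) = of_nat D * \<phi> (\<theta> x)" using k by simp
    then show ?thesis using xz z(2) D(1) by (intro exI[of _ "nat k"]) (simp add: field_simps)
  qed
  then show ?thesis
    using isomorphic_to_numerical_monoidI[OF M, of "z / of_nat D"] z0 D(1) by simp
qed

section \<open>Transfer homomorphisms\<close>

lemma Units_puiseux_monoid:
  assumes "puiseux_monoid M"
  shows "Units (additive_monoid_on M) = {0}"
proof -
  note MD = puiseux_monoidD[OF assms]
  have "x = 0" if "x \<in> Units (additive_monoid_on M)" for x
  proof -
    from that obtain y where "x \<in> M" "y \<in> M" "x + y = 0" unfolding Units_def by auto
    then show ?thesis using MD(1)[of x] MD(1)[of y] by linarith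
  qed
  moreover have "0 \<in> Units (additive_monoid_on M)"
    unfolding Units_def using MD(2) by simp
  ultimately show ?thesis by blast
qed

lemma comm_monoid_cancel_additive_monoid_on:
  fixes S :: "'a::cancel_comm_monoid_add set"
  assumes "submonoid S (additive_monoid_on UNIV)"
  shows "comm_monoid_cancel (additive_monoid_on S)"
proof -
  interpret S: submonoid S "additive_monoid_on UNIV" by (rule assms)
  have "0 \<in> S" "\<And>x y. x \<in> S \<Longrightarrow> y \<in> S \<Longrightarrow> x + y \<in> S"
    using S.one_closed S.m_closed by auto
  then have "comm_monoid (additive_monoid_on S)"
    by (intro comm_monoidI) (auto simp: add_ac)
  then show ?thesis by (rule comm_monoid_cancelI) auto
qed

text \<open>
  If all numbers from \<open>b > 0\<close> on belong to \<open>S\<close>, the elements below \<open>2 b\<close> generate \<open>S\<close>: from a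
  larger element \<open>b\<close> can be split off within \<open>S\<close>.
\<close>

lemma numerical_monoid_finitely_generated:
  assumes "numerical_monoid S"
  shows "finitely_generated_monoid (additive_monoid_on S)"
proof -
  interpret S: submonoid S "additive_monoid_on UNIV" using assms by (simp add: numerical_monoid_def)
  have S0: "0 \<in> S" and Sadd: "\<And>x y. x \<in> S \<Longrightarrow> y \<in> S \<Longrightarrow> x + y \<in> S"
    using S.one_closed S.m_closed by auto
  obtain b where b: "- S \<subseteq> {..<b}" "0 < b"
  proof -
    obtain b where "- S \<subseteq> {..<b}" 
      using assms finite_nat_bounded by (auto simp: numerical_monoid_def)
    then have "- S \<subseteq> {..<Suc b}" by (auto simp: subset_iff less_Suc_eq)
    then show thesis using that by blast
  qed
  have bS: "n \<in> S" if "b \<le> n" for n using b(1) that by (auto simp: subset_iff leD)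
  define A where "A = {s \<in> S. s < 2 * b}"
  have min: "S \<subseteq> H" if H: "submonoid H (additive_monoid_on S)" "A \<subseteq> H" for H
  proof
    fix n assume "n \<in> S"
    then show "n \<in> H"
    proof (induction n rule: less_induct)
      case (less n)
      show ?case
      proof (cases "n < 2 * b")
        case True
        then show ?thesis using less.prems H(2) by (auto simp: A_def)
      next
        case False
        then have "n - b \<in> H" using b(2) bS by (intro less.IH) auto
        moreover have "b \<in> H" using H(2) bS b(2) by (auto simp: A_def)
        ultimately have "(n - b) + b \<in> H" using submonoid.m_closed[OF H(1), of "n - b" b] by simp
        then show ?thesis using False by simp
      qed
    qed
  qed
  have "submonoid S (additive_monoid_on S)" by standard (auto simp: S0 Sadd)
  then have "(\<lambda>H. submonoid H (additive_monoid_on S)) hull A = S"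
    using min by (intro hull_unique) (auto simp: A_def)
  moreover have "finite A" "A \<subseteq> S" by (auto simp: A_def)
  ultimately show ?thesis unfolding finitely_generated_monoid_def by auto
qed

text \<open>
  The only point that is not mere transport along \<open>f\<close> is that \<open>f\<close> preserves the identity:
  the image of the identity is idempotent, and cancellation makes it the identity.
\<close>

lemma iso_imp_transfer_hom:
  assumes G: "monoid G" and N: "comm_monoid_cancel N" and f: "f \<in> iso G N"
  shows "f \<in> transfer_hom G N"
proof -
  interpret G: monoid G by (rule G)
  interpret N: comm_monoid_cancel N by (rule N)
  have hom: "f \<in> hom G N" and bij: "bij_betw f (carrier G) (carrier N)"
    using f by (auto simp: iso_def)
  have im: "f ` carrier G = carrier N" using bij by (simp add: bij_betw_def)
  have inj: "f x = f y \<longleftrightarrow> x = y" if "x \<in> carrier G" "y \<in> carrier G" for x y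
    using bij that by (auto simp: bij_betw_def inj_on_def)
  have c: "f x \<in> carrier N" if "x \<in> carrier G" for x using im that by blast
  have mult: "f (x \<otimes>\<^bsub>G\<^esub> y) = f x \<otimes>\<^bsub>N\<^esub> f y" if "x \<in> carrier G" "y \<in> carrier G" for x y
    using hom that by (simp add: hom_def)
  have "f \<one>\<^bsub>G\<^esub> \<otimes>\<^bsub>N\<^esub> f \<one>\<^bsub>G\<^esub> = f \<one>\<^bsub>G\<^esub> \<otimes>\<^bsub>N\<^esub> \<one>\<^bsub>N\<^esub>"
    using mult[of "\<one>\<^bsub>G\<^esub>" "\<one>\<^bsub>G\<^esub>"] c[of "\<one>\<^bsub>G\<^esub>"] by simp
  then have one: "f \<one>\<^bsub>G\<^esub> = \<one>\<^bsub>N\<^esub>" by (rule N.l_cancel) (simp_all add: c)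
  have pre: "\<exists>x\<in>carrier G. f x = y" if "y \<in> carrier N" for y
    using that unfolding im[symmetric] by auto
  have "carrier N = f ` carrier G <#>\<^bsub>N\<^esub> Units N"
  proof
    show "carrier N \<subseteq> f ` carrier G <#>\<^bsub>N\<^esub> Units N"
    proof
      fix x assume "x \<in> carrier N"
      then show "x \<in> f ` carrier G <#>\<^bsub>N\<^esub> Units N"
        unfolding im set_mult_def using N.Units_one_closed N.r_one[of x] by force
    qed
    show "f ` carrier G <#>\<^bsub>N\<^esub> Units N \<subseteq> carrier N"
      unfolding im set_mult_def by auto
  qed
  moreover have "{a \<in> carrier G. f a \<in> Units N} = Units G"
  proof (intro equalityI subsetI)
    fix a assume "a \<in> {a \<in> carrier G. f a \<in> Units N}"
    then obtain y where a: "a \<in> carrier G" and y: "y \<in> carrier N" "y \<otimes>\<^bsub>N\<^esub> f a = \<one>\<^bsub>N\<^esub>" "f a \<otimes>\<^bsub>N\<^esub> y = \<one>\<^bsub>N\<^esub>"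
      by (auto simp: Units_def)
    obtain x where x: "x \<in> carrier G" "f x = y" using pre[OF y(1)] by (elim bexE)
    have "f (x \<otimes>\<^bsub>G\<^esub> a) = f \<one>\<^bsub>G\<^esub>" "f (a \<otimes>\<^bsub>G\<^esub> x) = f \<one>\<^bsub>G\<^esub>"
      using x y a by (simp_all add: mult one)
    then have "x \<otimes>\<^bsub>G\<^esub> a = \<one>\<^bsub>G\<^esub>" "a \<otimes>\<^bsub>G\<^esub> x = \<one>\<^bsub>G\<^esub>" using x a by (simp_all add: inj)
    then show "a \<in> Units G" using x a by (auto simp: Units_def)
  next
    fix a assume "a \<in> Units G"
    then obtain x where a: "a \<in> carrier G" and x: "x \<in> carrier G" "x \<otimes>\<^bsub>G\<^esub> a = \<one>\<^bsub>G\<^esub>" "a \<otimes>\<^bsub>G\<^esub> x = \<one>\<^bsub>G\<^esub>"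
      by (auto simp: Units_def)
    have "f x \<otimes>\<^bsub>N\<^esub> f a = \<one>\<^bsub>N\<^esub>" "f a \<otimes>\<^bsub>N\<^esub> f x = \<one>\<^bsub>N\<^esub>"
      using a x by (simp_all add: mult[symmetric] one)
    then have "f a \<in> Units N" using c[OF a] c[OF x(1)] unfolding Units_def by auto
    then show "a \<in> {a \<in> carrier G. f a \<in> Units N}" using a by simp
  qed
  moreover have "\<exists>a1\<in>carrier G. \<exists>a2\<in>carrier G. a = a1 \<otimes>\<^bsub>G\<^esub> a2 \<and> f a1 = b1 \<and> f a2 = b2"
    if a: "a \<in> carrier G" "b1 \<in> carrier N" "b2 \<in> carrier N" "f a = b1 \<otimes>\<^bsub>N\<^esub> b2" for a b1 b2
  proof -
    obtain a1 a2 where x: "a1 \<in> carrier G" "f a1 = b1" "a2 \<in> carrier G" "f a2 = b2"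
      using pre[OF a(2)] pre[OF a(3)] by (elim bexE)
    then have "f a = f (a1 \<otimes>\<^bsub>G\<^esub> a2)" using a(4) by (simp add: mult)
    then have "a = a1 \<otimes>\<^bsub>G\<^esub> a2" using a(1) x by (simp add: inj)
    with x show ?thesis by (intro bexI[of _ a1] bexI[of _ a2]) simp_all
  qed
  ultimately show ?thesis using hom one by (simp add: transfer_hom_def monoid_hom_def)
qed

lemma transfer_finite_if_isomorphic_to_numerical_monoid:
  assumes M: "puiseux_monoid M" and "isomorphic_to_numerical_monoid M"
  shows "transfer_finite M"
proof -
  obtain S f where S: "numerical_monoid S" and f: "f \<in> iso (additive_monoid_on M) (additive_monoid_on S)"
    using assms(2) by (auto simp: isomorphic_to_numerical_monoid_def is_iso_def)
  have N: "comm_monoid_cancel (additive_monoid_on S)"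
    using S by (intro comm_monoid_cancel_additive_monoid_on) (simp add: numerical_monoid_def)
  have "monoid (additive_monoid_on M)"
    using puiseux_monoidD[OF M] by (intro monoidI) (auto simp: add_ac)
  from iso_imp_transfer_hom[OF this N f] show ?thesis
    by (rule transfer_finiteI[OF N numerical_monoid_finitely_generated[OF S]])
qed

lemma isomorphic_to_numerical_monoid_if_transfer_finite:
  assumes M: "puiseux_monoid M" "M \<noteq> {0}" and "transfer_finite M"
  shows "isomorphic_to_numerical_monoid M"
proof -
  obtain N :: "nat monoid" and \<theta> where N: "comm_monoid_cancel N" "finitely_generated_monoid N"
    and \<theta>: "\<theta> \<in> transfer_hom (additive_monoid_on M) N"
    using assms(3) by (auto simp: transfer_finite_def)
  interpret N: comm_monoid_cancel N by (rule N(1))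
  have hom: "\<theta> \<in> monoid_hom (additive_monoid_on M) N" and units: "{x \<in> M. \<theta> x \<in> Units N} = {0}"
    using \<theta> Units_puiseux_monoid[OF M(1)] by (auto simp: transfer_hom_def)
  have "{x \<in> M. \<theta> x = \<one>\<^bsub>N\<^esub>} = {0}"
  proof
    have "x \<in> {x \<in> M. \<theta> x \<in> Units N}" if "x \<in> M" "\<theta> x = \<one>\<^bsub>N\<^esub>" for x
      using that N.Units_one_closed by simp
    then show "{x \<in> M. \<theta> x = \<one>\<^bsub>N\<^esub>} \<subseteq> {0}" unfolding units by blast
    have "\<theta> 0 = \<one>\<^bsub>N\<^esub>" using hom by (simp add: monoid_hom_def)
    then show "{0} \<subseteq> {x \<in> M. \<theta> x = \<one>\<^bsub>N\<^esub>}" using puiseux_monoidD(2)[OF M(1)] by simp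
  qed
  from trivial_kernel_imp_isomorphic_to_numerical_monoid[OF M N hom this] show ?thesis .
qed

theorem theorem4p2:
  fixes M :: "rat set" and F :: "('b, 'm) monoid_scheme"
  assumes "puiseux_monoid M" and "M \<noteq> {0}"
    and "comm_monoid_cancel F" and "finitely_generated_monoid F"
  shows "(\<forall>\<theta> \<in> monoid_hom (additive_monoid_on M) F.
            {x \<in> M. \<theta> x = \<one>\<^bsub>F\<^esub>} = {0} \<longrightarrow> isomorphic_to_numerical_monoid M) \<and>
         (transfer_finite M \<longleftrightarrow> isomorphic_to_numerical_monoid M)"
proof (intro conjI ballI impI iffI)
  show "isomorphic_to_numerical_monoid M"
    if "\<theta> \<in> monoid_hom (additive_monoid_on M) F" and "{x \<in> M. \<theta> x = \<one>\<^bsub>F\<^esub>} = {0}" for \<theta>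
    using trivial_kernel_imp_isomorphic_to_numerical_monoid[OF assms that] .
  show "isomorphic_to_numerical_monoid M" if "transfer_finite M"
    using isomorphic_to_numerical_monoid_if_transfer_finite[OF assms(1,2) that] .
  show "transfer_finite M" if "isomorphic_to_numerical_monoid M"
    using transfer_finite_if_isomorphic_to_numerical_monoid[OF assms(1) that] .
qed

end
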